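(* Let $H$ be a connected involutive graph of order $n$ with $D(H)\geq 2$, and let $F$ be a connected graph relatively prime to $H$ with respect to the Cartesian product. Put $d=D(H)$. If $$D(F)\leq \binom{\frac{n+d^2+d}{2}-1}{\frac{d^2+d}{2}-1},$$ then $D_\mathcal{R}(H\square F)\leq d^2+d-2$.
   Context: All graphs are finite and simple. $D(X)$ is the distinguishing number: the least $d$ such that $X$ has a coloring $c:V(X)\to\{1,\dots,d\}$ whose only color-preserving automorphism is the identity (such a coloring is called distinguishing). An involutive graph is a graph $H$ together with a map $u\mapsto\overline u$ on $V(H)$ such that $\overline{\overline u}=u$, $\overline u\neq u$ for all $u$, and $\sigma(\overline u)=\overline{\sigma(u)}$ for every automorphism $\sigma$ of $H$ and every vertex $u$. Two graphs are relatively prime if they have no common non-trivial factor with respect to the Cartesian product $\square$. The distinguishing game on a graph $X$ with $d$ colors: Gentle and Rascal alternately choose an uncolored vertex and color it with one of the $d$ colors; when all vertices are colored, Gentle wins iff the coloring is distinguishing. $D_\mathcal{R}(X)$ is the least $d$ such that Gentle has a winning strategy with $d$ colors when Rascal moves first ($\infty$ if none exists). *)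

theory Defs
  imports "Graph_Theory.Graph_Theory" "HOL-Library.Extended_Nat" "HOL-Library.FuncSet"
begin

text \<open>
  A finite simple graph is a \<^locale>\<open>pair_graph\<close>: an edge is represented by its two arcs \<open>(u, v)\<close>
  and \<open>(v, u)\<close>.  Maps on the vertices of a graph are total functions of which only the
  values on the vertex set matter.
\<close>

definition graph_automorphism :: "'a pair_pre_digraph \<Rightarrow> ('a \<Rightarrow> 'a) \<Rightarrow> bool" where
  "graph_automorphism X \<sigma> \<longleftrightarrow> bij_betw \<sigma> (pverts X) (pverts X) \<and>
     (\<forall>u\<in>pverts X. \<forall>v\<in>pverts X. (\<sigma> u, \<sigma> v) \<in> parcs X \<longleftrightarrow> (u, v) \<in> parcs X)"

definition distinguishing :: "'a pair_pre_digraph \<Rightarrow> ('a \<Rightarrow> nat) \<Rightarrow> bool" where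
  "distinguishing X c \<longleftrightarrow>
     (\<forall>\<sigma>. graph_automorphism X \<sigma> \<and> (\<forall>u\<in>pverts X. c (\<sigma> u) = c u) \<longrightarrow> (\<forall>u\<in>pverts X. \<sigma> u = u))"

definition distinguishing_number :: "'a pair_pre_digraph \<Rightarrow> nat" where
  "distinguishing_number X = (LEAST d. \<exists>c. c \<in> pverts X \<rightarrow> {1..d} \<and> distinguishing X c)"

definition involutive_graph :: "'a pair_pre_digraph \<Rightarrow> ('a \<Rightarrow> 'a) \<Rightarrow> bool" where
  "involutive_graph H bar \<longleftrightarrow> pair_graph H \<and> bar \<in> pverts H \<rightarrow> pverts H \<and>
     (\<forall>u\<in>pverts H. bar (bar u) = u \<and> bar u \<noteq> u) \<and>
     (\<forall>\<sigma>. graph_automorphism H \<sigma> \<longrightarrow> (\<forall>u\<in>pverts H. \<sigma> (bar u) = bar (\<sigma> u)))"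

definition cartesian_product ::
    "'a pair_pre_digraph \<Rightarrow> 'b pair_pre_digraph \<Rightarrow> ('a \<times> 'b) pair_pre_digraph" (infixr "\<box>" 75) where
  "X \<box> Y = \<lparr> pverts = pverts X \<times> pverts Y,
     parcs = {((x, y), (x', y')). (x = x' \<and> x \<in> pverts X \<and> (y, y') \<in> parcs Y) \<or>
                                  ((x, x') \<in> parcs X \<and> y = y' \<and> y \<in> pverts Y)} \<rparr>"

text \<open>
  Every finite graph is isomorphic to one whose vertices are natural numbers, so restricting
  the cofactor \<open>Y\<close>, and the common factor \<open>K\<close> below, to the vertex type \<^typ>\<open>nat\<close> loses nothing.
\<close>

definition cartesian_factor :: "'b pair_pre_digraph \<Rightarrow> 'a pair_pre_digraph \<Rightarrow> bool" where
  "cartesian_factor K X \<longleftrightarrow> pair_graph K \<and>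
     (\<exists>Y :: nat pair_pre_digraph. pair_graph Y \<and> digraph_iso (with_proj X) (with_proj (K \<box> Y)))"

definition relatively_prime :: "'a pair_pre_digraph \<Rightarrow> 'b pair_pre_digraph \<Rightarrow> bool" where
  "relatively_prime X Y \<longleftrightarrow>
     \<not> (\<exists>K :: nat pair_pre_digraph. card (pverts K) \<ge> 2 \<and> cartesian_factor K X \<and> cartesian_factor K Y)"

text \<open>
  A play is the list of the moves made so far, in chronological order; a move is a vertex
  together with its color.  Rascal makes the moves at the even positions 0, 2, \<dots> of this list
  and Gentle those at the odd positions.  A strategy for Gentle chooses the next move from
  the play so far.
\<close>

definition legal_play :: "'a pair_pre_digraph \<Rightarrow> nat \<Rightarrow> ('a \<times> nat) list \<Rightarrow> bool" where
  "legal_play X d p \<longleftrightarrow> distinct (map fst p) \<and> set p \<subseteq> pverts X \<times> {1..d}"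

definition follows_strategy :: "(('a \<times> nat) list \<Rightarrow> 'a \<times> nat) \<Rightarrow> ('a \<times> nat) list \<Rightarrow> bool" where
  "follows_strategy s p \<longleftrightarrow> (\<forall>i<length p. odd i \<longrightarrow> p ! i = s (take i p))"

definition winning_strategy ::
    "'a pair_pre_digraph \<Rightarrow> nat \<Rightarrow> (('a \<times> nat) list \<Rightarrow> 'a \<times> nat) \<Rightarrow> bool" where
  "winning_strategy X d s \<longleftrightarrow>
     (\<forall>p. legal_play X d p \<and> follows_strategy s p \<and> odd (length p) \<and> length p < card (pverts X)
        \<longrightarrow> legal_play X d (p @ [s p])) \<and>
     (\<forall>p. legal_play X d p \<and> follows_strategy s p \<and> length p = card (pverts X)
        \<longrightarrow> distinguishing X (\<lambda>u. the (map_of p u)))"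

text \<open>
  The game needs at least one color: with none, Rascal could not move and every strategy of
  Gentle would be vacuously winning.  The infimum of the empty set in \<^typ>\<open>enat\<close> is \<open>\<infinity>\<close>.
\<close>

definition rascal_distinguishing_number :: "'a pair_pre_digraph \<Rightarrow> enat" where
  "rascal_distinguishing_number X = Inf {enat d | d. d \<ge> 1 \<and> (\<exists>s. winning_strategy X d s)}"

end

theory Submission
  imports Defs
begin

text \<open>
  Since \<open>H\<close> and \<open>F\<close> are connected and relatively prime, every automorphism of \<open>H \<box> F\<close> is a product
  \<open>\<alpha> \<times> \<beta>\<close>.  Gentle answers each move in \<open>(u, f)\<close> by a move in \<open>(bar u, f)\<close>; with \<open>d\<^sup>2 + d - 2\<close> colors the
  resulting ordered pair of colors can encode any element of \<open>{1..d} \<times> {1..d}\<close>, whatever Rascal's color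
  was, in such a way that reversing the colors reverses the encoded pair.  So Gentle can realize a prescribed
  coloring of each \<open>H\<close>-layer with \<open>d\<close> colors, readable from the final position by every automorphism,
  because automorphisms of \<open>H\<close> commute with \<open>bar\<close>.  The multiset of the \<open>n / 2\<close> unordered pairs
  \<open>{c u, c (bar u)}\<close> of a layer is invariant under \<open>\<alpha>\<close>, and there are enough such multisets to represent
  the colors of a distinguishing coloring of \<open>F\<close>, which forces \<open>\<beta> = id\<close>.  If moreover one layer carries a
  distinguishing coloring of \<open>H\<close>, then \<open>\<alpha> = id\<close> too.

  That automorphisms are products is shown without prime factorizations.  Opposite edges of a 4-cycle have the
  same direction, so for any two decompositions \<open>A \<box> B\<close> and \<open>C \<box> D\<close> of a graph the coordinate projections
  commute.  Hence the intersection of an \<open>A\<close>-layer and a \<open>D\<close>-layer is a common factor of \<open>A\<close> and \<open>D\<close>.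
\<close>

section \<open>Graph isomorphisms and Cartesian products\<close>

text \<open>The working notion, a vertex map between graphs on possibly different types. The
  arc-carrying \<open>digraph_iso\<close> of \<open>cartesian_factor\<close> is reached from it
  through \<open>digraph_iso_with_proj\<close>.\<close>

definition graph_isomorphism :: "('a \<Rightarrow> 'b) \<Rightarrow> 'a pair_pre_digraph \<Rightarrow> 'b pair_pre_digraph \<Rightarrow> bool" where
  "graph_isomorphism \<phi> X Y \<longleftrightarrow> bij_betw \<phi> (pverts X) (pverts Y) \<and>
     (\<forall>u\<in>pverts X. \<forall>v\<in>pverts X. (\<phi> u, \<phi> v) \<in> parcs Y \<longleftrightarrow> (u, v) \<in> parcs X)"

lemma graph_automorphism_iff: "graph_automorphism X \<sigma> \<longleftrightarrow> graph_isomorphism \<sigma> X X"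
  by (simp add: graph_automorphism_def graph_isomorphism_def)

lemma graph_isomorphism_in: "graph_isomorphism \<phi> X Y \<Longrightarrow> x \<in> pverts X \<Longrightarrow> \<phi> x \<in> pverts Y"
  by (auto simp: graph_isomorphism_def dest: bij_betwE)

lemma graph_isomorphism_inj:
  "graph_isomorphism \<phi> X Y \<Longrightarrow> x \<in> pverts X \<Longrightarrow> y \<in> pverts X \<Longrightarrow> \<phi> x = \<phi> y \<longleftrightarrow> x = y"
  by (auto simp: graph_isomorphism_def bij_betw_def dest: inj_onD)

lemma graph_isomorphism_arcs:
  "graph_isomorphism \<phi> X Y \<Longrightarrow> x \<in> pverts X \<Longrightarrow> y \<in> pverts X \<Longrightarrow> (\<phi> x, \<phi> y) \<in> parcs Y \<longleftrightarrow> (x, y) \<in> parcs X"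
  by (auto simp: graph_isomorphism_def)

lemma graph_isomorphism_comp:
  assumes "graph_isomorphism \<phi> X Y" and "graph_isomorphism \<psi> Y Z"
  shows "graph_isomorphism (\<psi> \<circ> \<phi>) X Z"
  using assms bij_betw_trans[of \<phi> "pverts X" "pverts Y" \<psi> "pverts Z"] bij_betwE[of \<phi>]
  unfolding graph_isomorphism_def by auto

lemma graph_isomorphism_inv_into:
  assumes "graph_isomorphism \<phi> X Y"
  shows "graph_isomorphism (inv_into (pverts X) \<phi>) Y X"
proof -
  have bij: "bij_betw \<phi> (pverts X) (pverts Y)"
    using assms by (simp add: graph_isomorphism_def)
  have "inv_into (pverts X) \<phi> v \<in> pverts X" "\<phi> (inv_into (pverts X) \<phi> v) = v" if "v \<in> pverts Y" for v
    using bij that by (auto simp: bij_betw_def inv_into_into f_inv_into_f)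
  then show ?thesis
    using assms bij_betw_inv_into[OF bij] unfolding graph_isomorphism_def by metis
qed

lemma pair_graph_arcD:
  assumes "pair_graph X" and "(u, v) \<in> parcs X"
  shows "u \<in> pverts X" and "v \<in> pverts X" and "u \<noteq> v" and "(v, u) \<in> parcs X"
proof -
  interpret pair_graph X by fact
  show "u \<in> pverts X" "v \<in> pverts X" "u \<noteq> v"
    using assms(2) wellformed' no_loops' by auto
  show "(v, u) \<in> parcs X"
    using assms(2) arcs_symmetric by simp
qed

lemma pair_graph_finite: "pair_graph X \<Longrightarrow> finite (pverts X)"
  by (simp add: pair_graph_def pair_digraph_def pair_fin_digraph_def pair_fin_digraph_axioms_def)

lemma pair_graphI:
  assumes "finite (pverts X)"
    and "\<And>u v. (u, v) \<in> parcs X \<Longrightarrow> u \<in> pverts X \<and> v \<in> pverts X \<and> u \<noteq> v \<and> (v, u) \<in> parcs X"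
  shows "pair_graph X"
proof -
  have "parcs X \<subseteq> pverts X \<times> pverts X"
    using assms(2) by auto
  then have "finite (parcs X)"
    using assms(1) by (meson finite_SigmaI finite_subset)
  then show ?thesis
    using assms by unfold_locales (auto simp: symmetric_def sym_def)
qed

text \<open>Connectivity in the form that starts an induction along a walk, as in
  \<open>transport_arc\<close> and \<open>transport_fst\<close>.\<close>

lemma pair_graph_rtrancl_on:
  assumes "pair_graph X" and "connected (with_proj X)" and "u \<in> pverts X" and "v \<in> pverts X"
  shows "(u, v) \<in> rtrancl_on (pverts X) (parcs X)"
proof -
  interpret pair_graph X by fact
  have "strongly_connected (with_proj X)"
    using assms(2) symmetric_connected_imp_strongly_connected pair_sym_arcs by blast
  then show ?thesis
    using assms(3,4) by (auto simp: strongly_connected_def reachable_def)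
qed

text \<open>The vertex map induces \<open>map_prod \<phi> \<phi>\<close> on arcs. The condition on
  \<open>parcs Y\<close> rules out arcs with ends outside \<open>pverts Y\<close>, which would have
  no preimage.\<close>

lemma digraph_iso_with_proj:
  assumes "pair_graph X" and "graph_isomorphism \<phi> X Y" and "parcs Y \<subseteq> pverts Y \<times> pverts Y"
  shows "digraph_iso (with_proj X) (with_proj Y)"
proof -
  interpret pair_graph X by fact
  let ?f = "\<lparr>iso_verts = \<phi>, iso_arcs = map_prod \<phi> \<phi>, iso_head = snd, iso_tail = fst\<rparr>"
  have inj: "inj_on \<phi> (pverts X)" and img: "\<phi> ` pverts X = pverts Y"
    using assms(2) by (auto simp: graph_isomorphism_def bij_betw_def)
  have "parcs X \<subseteq> pverts X \<times> pverts X"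
    using wellformed' by auto
  then have inj2: "inj_on (map_prod \<phi> \<phi>) (parcs X)"
    using map_prod_inj_on[OF inj inj] inj_on_subset by blast
  have "map_prod \<phi> \<phi> ` parcs X = parcs Y"
  proof (intro equalityI subsetI)
    fix e assume "e \<in> map_prod \<phi> \<phi> ` parcs X"
    then show "e \<in> parcs Y"
      using wellformed' graph_isomorphism_arcs[OF assms(2)] by auto
  next
    fix e assume e: "e \<in> parcs Y"
    then obtain u v where "u \<in> pverts X" "v \<in> pverts X" "e = (\<phi> u, \<phi> v)"
      using assms(3) img by blast
    then show "e \<in> map_prod \<phi> \<phi> ` parcs X"
      using e graph_isomorphism_arcs[OF assms(2)] by force
  qed
  then have "with_proj Y = app_iso ?f (with_proj X)"
    using img by (simp add: app_iso_def with_proj_def)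
  moreover have "pre_digraph.digraph_isomorphism (with_proj X) ?f"
    unfolding pre_digraph.digraph_isomorphism_def using inj inj2 wf_digraph_axioms by simp
  ultimately show ?thesis
    unfolding digraph_iso_def by blast
qed

section \<open>Cartesian products and their factors\<close>

lemma pverts_cartesian_product [simp]: "pverts (X \<box> Y) = pverts X \<times> pverts Y"
  by (simp add: cartesian_product_def)

lemma parcs_cartesian_product:
  "(p, q) \<in> parcs (X \<box> Y) \<longleftrightarrow> (fst p = fst q \<and> fst p \<in> pverts X \<and> (snd p, snd q) \<in> parcs Y) \<or>
     ((fst p, fst q) \<in> parcs X \<and> snd p = snd q \<and> snd p \<in> pverts Y)"
  by (auto simp: cartesian_product_def)

lemma pair_graph_cartesian_product:
  assumes "pair_graph X" and "pair_graph Y"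
  shows "pair_graph (X \<box> Y)"
  by (rule pair_graphI)
    (use assms in \<open>auto simp: parcs_cartesian_product pair_graph_finite dest: pair_graph_arcD\<close>)

lemma graph_isomorphism_map_prod:
  assumes "graph_isomorphism \<phi> X X'" and "graph_isomorphism \<psi> Y Y'"
  shows "graph_isomorphism (map_prod \<phi> \<psi>) (X \<box> Y) (X' \<box> Y')"
  using assms bij_betw_map_prod[of \<phi> "pverts X" "pverts X'" \<psi> "pverts Y" "pverts Y'"]
  unfolding graph_isomorphism_def[of "map_prod \<phi> \<psi>"]
  by (auto simp: parcs_cartesian_product graph_isomorphism_in graph_isomorphism_inj
      graph_isomorphism_arcs graph_isomorphism_def[of \<phi>] graph_isomorphism_def[of \<psi>])

lemma graph_isomorphism_swap: "graph_isomorphism prod.swap (X \<box> Y) (Y \<box> X)"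
  unfolding graph_isomorphism_def
  by (auto simp: parcs_cartesian_product bij_betw_def image_iff product_swap)

text \<open>\<open>relatively_prime\<close> and \<open>cartesian_factor\<close> quantify over graphs
  on \<open>nat\<close>, so factors found on other vertex types are renumbered.\<close>

lemma pair_graph_nat_copy:
  assumes "pair_graph X"
  obtains \<nu> and X' :: "nat pair_pre_digraph" where "pair_graph X'" and "graph_isomorphism \<nu> X' X"
proof -
  obtain h where h: "bij_betw h {0..<card (pverts X)} (pverts X)"
    using ex_bij_betw_nat_finite[OF pair_graph_finite[OF assms]] by blast
  let ?N = "{0..<card (pverts X)}"
  let ?X' = "\<lparr>pverts = ?N, parcs = {(i, j). i \<in> ?N \<and> j \<in> ?N \<and> (h i, h j) \<in> parcs X}\<rparr>"
  have "pair_graph ?X'"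
    by (rule pair_graphI) (auto dest: pair_graph_arcD[OF assms])
  moreover have "graph_isomorphism h ?X' X"
    using h by (auto simp: graph_isomorphism_def)
  ultimately show thesis
    using that by blast
qed

lemma cartesian_factorI:
  assumes "pair_graph X" and "pair_graph K" and "pair_graph Y" and "graph_isomorphism \<phi> (K \<box> Y) X"
  shows "cartesian_factor K X"
proof -
  obtain \<nu> and Y' :: "nat pair_pre_digraph"
    where Y': "pair_graph Y'" and \<nu>: "graph_isomorphism \<nu> Y' Y"
    using pair_graph_nat_copy[OF assms(3)] by blast
  have "graph_isomorphism id K K"
    by (simp add: graph_isomorphism_def)
  then have "graph_isomorphism (\<phi> \<circ> map_prod id \<nu>) (K \<box> Y') X"
    using graph_isomorphism_comp graph_isomorphism_map_prod \<nu> assms(4) by blast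
  then have "graph_isomorphism (inv_into (pverts (K \<box> Y')) (\<phi> \<circ> map_prod id \<nu>)) X (K \<box> Y')"
    by (rule graph_isomorphism_inv_into)
  moreover have "parcs (K \<box> Y') \<subseteq> pverts (K \<box> Y') \<times> pverts (K \<box> Y')"
    using pair_graph_arcD[OF pair_graph_cartesian_product[OF assms(2) Y']] by auto
  ultimately show ?thesis
    unfolding cartesian_factor_def using assms(1,2) Y' digraph_iso_with_proj by blast
qed

lemma relatively_prime_commute: "relatively_prime X Y \<longleftrightarrow> relatively_prime Y X"
  by (auto simp: relatively_prime_def)

text \<open>If the edge from \<open>r\<close> to \<open>s\<close> changed the second coordinate,
  then one of the two remaining edges would have to bring the first coordinate back to
  \<open>fst p\<close>, and the other would have to undo the change of the second. This forces
  \<open>p = r\<close> or \<open>q = s\<close>.\<close>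

lemma cartesian_product_opposite_edges:
  assumes "pair_graph A" and "pair_graph B"
    and "(p, q) \<in> parcs (A \<box> B)" and "(q, r) \<in> parcs (A \<box> B)"
    and "(r, s) \<in> parcs (A \<box> B)" and "(s, p) \<in> parcs (A \<box> B)"
    and "p \<noteq> r" and "q \<noteq> s" and "snd p = snd q"
  shows "snd s = snd r"
  using assms(3-9) pair_graph_arcD(3)[OF assms(1)] pair_graph_arcD(3)[OF assms(2)]
  unfolding parcs_cartesian_product prod_eq_iff by metis

section \<open>Two decompositions of the same graph\<close>

definition induced :: "'a pair_pre_digraph \<Rightarrow> 'a set \<Rightarrow> 'a pair_pre_digraph" where
  "induced X S = \<lparr>pverts = S, parcs = parcs X \<inter> S \<times> S\<rparr>"

lemma pverts_induced [simp]: "pverts (induced X S) = S"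
  and parcs_induced [simp]: "parcs (induced X S) = parcs X \<inter> S \<times> S"
  by (simp_all add: induced_def)

lemma pair_graph_induced:
  assumes "pair_graph X" and "S \<subseteq> pverts X"
  shows "pair_graph (induced X S)"
  by (rule pair_graphI)
    (use assms finite_subset[OF assms(2)] in \<open>auto simp: pair_graph_finite dest: pair_graph_arcD\<close>)

text \<open>\<open>\<psi>\<close> makes \<open>C \<box> D\<close> a second decomposition of the
  graph \<open>A \<box> B\<close>. The setting is symmetric under swapping factors on either side
  and under inversion, so each fact is proved for one choice of coordinates and reused through
  \<open>swap_domain\<close>, \<open>swap_codomain\<close> and \<open>inverse\<close>.\<close>

locale product_isomorphism =
  fixes A :: "'a pair_pre_digraph" and B :: "'b pair_pre_digraph"
    and C :: "'c pair_pre_digraph" and D :: "'d pair_pre_digraph"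
    and \<psi> :: "'c \<times> 'd \<Rightarrow> 'a \<times> 'b"
  assumes graphs: "pair_graph A" "pair_graph B" "pair_graph C" "pair_graph D"
    and conn: "connected (with_proj A)" "connected (with_proj B)"
      "connected (with_proj C)" "connected (with_proj D)"
    and iso: "graph_isomorphism \<psi> (C \<box> D) (A \<box> B)"
begin

lemma swap_domain: "product_isomorphism A B D C (\<psi> \<circ> prod.swap)"
  using graphs conn graph_isomorphism_comp[OF graph_isomorphism_swap iso]
  by (simp add: product_isomorphism_def)

lemma swap_codomain: "product_isomorphism B A C D (prod.swap \<circ> \<psi>)"
  using graphs conn graph_isomorphism_comp[OF iso graph_isomorphism_swap]
  by (simp add: product_isomorphism_def)

lemma inverse: "product_isomorphism C D A B (inv_into (pverts C \<times> pverts D) \<psi>)"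
  using graphs conn graph_isomorphism_inv_into[OF iso]
  by (simp add: product_isomorphism_def)

lemma in_verts:
  assumes "z \<in> pverts C \<times> pverts D"
  shows "\<psi> z \<in> pverts A \<times> pverts B"
  using graph_isomorphism_in[OF iso] assms by simp

lemma inj:
  assumes "z \<in> pverts C \<times> pverts D" and "z' \<in> pverts C \<times> pverts D"
  shows "\<psi> z = \<psi> z' \<longleftrightarrow> z = z'"
  using graph_isomorphism_inj[OF iso] assms by simp

lemma arcs:
  assumes "z \<in> pverts C \<times> pverts D" and "z' \<in> pverts C \<times> pverts D"
  shows "(\<psi> z, \<psi> z') \<in> parcs (A \<box> B) \<longleftrightarrow> (z, z') \<in> parcs (C \<box> D)"
  using graph_isomorphism_arcs[OF iso] assms by simp

lemma surj:
  assumes "x \<in> pverts A \<times> pverts B"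
  obtains z where "z \<in> pverts C \<times> pverts D" and "\<psi> z = x"
proof -
  have "\<psi> ` (pverts C \<times> pverts D) = pverts A \<times> pverts B"
    using iso by (simp add: graph_isomorphism_def bij_betw_def)
  with assms have "x \<in> \<psi> ` (pverts C \<times> pverts D)"
    by simp
  then show thesis
    using that by blast
qed

text \<open>Moving a \<open>C\<close>-edge along one \<open>D\<close>-edge sweeps out a 4-cycle,
  whose opposite edges have the same direction in \<open>A \<box> B\<close>. Hence a
  \<open>C\<close>-edge inside an \<open>A\<close>-layer stays inside an \<open>A\<close>-layer
  along a whole \<open>D\<close>-walk.\<close>

lemma transport_arc:
  assumes c: "(c, c') \<in> parcs C" and \<delta>: "\<delta> \<in> pverts D" "\<delta>' \<in> pverts D"
    and eq: "snd (\<psi> (c, \<delta>)) = snd (\<psi> (c', \<delta>))"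
  shows "snd (\<psi> (c, \<delta>')) = snd (\<psi> (c', \<delta>'))"
  using pair_graph_rtrancl_on[OF graphs(4) conn(4) \<delta>]
proof (induction rule: rtrancl_on_induct)
  case base
  show ?case by (rule eq)
next
  case (step \<delta>1 \<delta>2)
  note cD = pair_graph_arcD[OF graphs(3) c] and dD = pair_graph_arcD[OF graphs(4) step.hyps(2)]
  have "(\<psi> (c, \<delta>1), \<psi> (c', \<delta>1)) \<in> parcs (A \<box> B)" "(\<psi> (c', \<delta>1), \<psi> (c', \<delta>2)) \<in> parcs (A \<box> B)"
    "(\<psi> (c', \<delta>2), \<psi> (c, \<delta>2)) \<in> parcs (A \<box> B)" "(\<psi> (c, \<delta>2), \<psi> (c, \<delta>1)) \<in> parcs (A \<box> B)"
    using cD dD c step.hyps(2) by (subst arcs; simp add: parcs_cartesian_product)+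
  moreover have "\<psi> (c, \<delta>1) \<noteq> \<psi> (c', \<delta>2)" "\<psi> (c', \<delta>1) \<noteq> \<psi> (c, \<delta>2)"
    using cD dD by (simp_all add: inj)
  ultimately show ?case
    using cartesian_product_opposite_edges[OF graphs(1,2)] step.IH by blast
qed

text \<open>Walk from \<open>z\<close> to \<open>z'\<close> inside their \<open>A\<close>-layer.
  Each step is a \<open>D\<close>-edge, which vanishes when the second coordinate is replaced by
  \<open>\<delta>\<close>, or a \<open>C\<close>-edge, which \<open>transport_arc\<close> moves to
  height \<open>\<delta>\<close>.\<close>

lemma transport_fst:
  assumes z: "z \<in> pverts C \<times> pverts D" and z': "z' \<in> pverts C \<times> pverts D"
    and \<delta>: "\<delta> \<in> pverts D" and eq: "snd (\<psi> z) = snd (\<psi> z')"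
  shows "snd (\<psi> (fst z, \<delta>)) = snd (\<psi> (fst z', \<delta>))"
proof -
  have a: "fst (\<psi> z) \<in> pverts A" "fst (\<psi> z') \<in> pverts A" and b: "snd (\<psi> z) \<in> pverts B"
    using in_verts[OF z] in_verts[OF z'] by auto
  have "(fst (\<psi> z), fst (\<psi> z')) \<in> rtrancl_on (pverts A) (parcs A)"
    by (rule pair_graph_rtrancl_on[OF graphs(1) conn(1) a])
  \<comment> \<open>The walk runs in \<open>A\<close>, so the induction claim speaks of whichever
    vertex of \<open>C \<box> D\<close> lies over the current \<open>a\<close> in the layer of
    \<open>z\<close>.\<close>
  then have "\<forall>z'\<in>pverts C \<times> pverts D. fst (\<psi> z') = a \<and> snd (\<psi> z') = snd (\<psi> z) \<longrightarrow>
      snd (\<psi> (fst z, \<delta>)) = snd (\<psi> (fst z', \<delta>))" if "a = fst (\<psi> z')" for a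
    unfolding that[symmetric]
  proof (induction rule: rtrancl_on_induct)
    case base
    show ?case
    proof (intro ballI impI)
      fix z' assume z': "z' \<in> pverts C \<times> pverts D" and "fst (\<psi> z') = fst (\<psi> z) \<and> snd (\<psi> z') = snd (\<psi> z)"
      then have "z' = z"
        using inj[OF z' z] by (simp add: prod_eq_iff)
      then show "snd (\<psi> (fst z, \<delta>)) = snd (\<psi> (fst z', \<delta>))"
        by simp
    qed
  next
    case (step a1 a2)
    show ?case
    proof (intro ballI impI)
      fix z2 assume z2: "z2 \<in> pverts C \<times> pverts D" and \<psi>z2: "fst (\<psi> z2) = a2 \<and> snd (\<psi> z2) = snd (\<psi> z)"
      obtain z1 where z1: "z1 \<in> pverts C \<times> pverts D" and \<psi>z1: "\<psi> z1 = (a1, snd (\<psi> z))"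
        using surj step.hyps(3) b by (metis mem_Sigma_iff)
      have IH: "snd (\<psi> (fst z, \<delta>)) = snd (\<psi> (fst z1, \<delta>))"
        using bspec[OF step.IH z1] \<psi>z1 by simp
      have "(\<psi> z1, \<psi> z2) \<in> parcs (A \<box> B)"
        using step.hyps(2) b \<psi>z1 \<psi>z2 by (simp add: parcs_cartesian_product)
      then have "(z1, z2) \<in> parcs (C \<box> D)"
        by (simp only: arcs[OF z1 z2])
      then consider "fst z1 = fst z2" | "(fst z1, fst z2) \<in> parcs C" "snd z1 = snd z2"
        by (auto simp: parcs_cartesian_product)
      then show "snd (\<psi> (fst z, \<delta>)) = snd (\<psi> (fst z2, \<delta>))"
      proof cases
        case 1
        then show ?thesis using IH by simp
      next
        case 2
        then show ?thesis
          using IH transport_arc[OF 2(1), of "snd z1" \<delta>] z1 \<delta> \<psi>z1 \<psi>z2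
          by (metis mem_Sigma_iff prod.collapse snd_conv)
      qed
    qed
  qed
  from bspec[OF this[OF refl] z'] show ?thesis
    using eq by simp
qed

text \<open>Lying in a common \<open>A\<close>-layer is a congruence for combining the first
  coordinate of one vertex with the second of another: change the two coordinates one after the
  other.\<close>

lemma transport:
  assumes z: "z \<in> pverts C \<times> pverts D" and z': "z' \<in> pverts C \<times> pverts D"
    and w: "w \<in> pverts C \<times> pverts D" and w': "w' \<in> pverts C \<times> pverts D"
    and "snd (\<psi> z) = snd (\<psi> z')" and "snd (\<psi> w) = snd (\<psi> w')"
  shows "snd (\<psi> (fst z, snd w)) = snd (\<psi> (fst z', snd w'))"
proof -
  interpret sd: product_isomorphism A B D C "\<psi> \<circ> prod.swap"
    by (rule swap_domain)
  have "snd (\<psi> (fst z, snd w)) = snd (\<psi> (fst z', snd w))"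
    using transport_fst[OF z z', of "snd w"] assms by auto
  also have "\<dots> = snd (\<psi> (fst z', snd w'))"
    using sd.transport_fst[of "prod.swap w" "prod.swap w'" "fst z'"] assms by auto
  finally show ?thesis .
qed

text \<open>Viewed in \<open>C \<box> D\<close>, the \<open>A\<close>-layer through
  \<open>x0\<close> is a box, because by \<open>transport\<close> it is closed under mixing
  coordinates. Its sides are its intersections with the \<open>D\<close>-layer and the
  \<open>C\<close>-layer through \<open>x0\<close>.\<close>

lemma layer_factorization:
  assumes x0: "x0 \<in> pverts C \<times> pverts D"
  shows "graph_isomorphism (\<lambda>(\<delta>, c). fst (\<psi> (c, \<delta>)))
    (induced D {\<delta> \<in> pverts D. snd (\<psi> (fst x0, \<delta>)) = snd (\<psi> x0)} \<box>
     induced C {c \<in> pverts C. snd (\<psi> (c, snd x0)) = snd (\<psi> x0)}) A"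
    (is "graph_isomorphism ?\<phi> (induced D ?W \<box> induced C ?U) A")
proof -
  have snd_eq: "snd (\<psi> (c, \<delta>)) = snd (\<psi> x0)" if "\<delta> \<in> ?W" "c \<in> ?U" for \<delta> c
    using transport[of "(c, snd x0)" x0 "(fst x0, \<delta>)" x0] that x0 by auto
  have inj_\<phi>: "inj_on ?\<phi> (?W \<times> ?U)"
  proof (rule inj_onI, clarify)
    fix \<delta> c \<delta>' c'
    assume W: "\<delta> \<in> pverts D" "snd (\<psi> (fst x0, \<delta>)) = snd (\<psi> x0)" "\<delta>' \<in> pverts D" "snd (\<psi> (fst x0, \<delta>')) = snd (\<psi> x0)"
      and U: "c \<in> pverts C" "snd (\<psi> (c, snd x0)) = snd (\<psi> x0)" "c' \<in> pverts C" "snd (\<psi> (c', snd x0)) = snd (\<psi> x0)"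
      and eq: "fst (\<psi> (c, \<delta>)) = fst (\<psi> (c', \<delta>'))"
    then have "\<psi> (c, \<delta>) = \<psi> (c', \<delta>')"
      using snd_eq[of \<delta> c] snd_eq[of \<delta>' c'] by (simp add: prod_eq_iff)
    then show "\<delta> = \<delta>' \<and> c = c'"
      using W U inj[of "(c, \<delta>)" "(c', \<delta>')"] by simp
  qed
  have "a \<in> ?\<phi> ` (?W \<times> ?U)" if a: "a \<in> pverts A" for a
  proof -
    obtain c \<delta> where z: "(c, \<delta>) \<in> pverts C \<times> pverts D" and \<psi>z: "\<psi> (c, \<delta>) = (a, snd (\<psi> x0))"
      using surj[of "(a, snd (\<psi> x0))"] a in_verts[OF x0] by (metis mem_Sigma_iff prod.collapse)
    \<comment> \<open>Mixing \<open>(c, \<delta>)\<close> with \<open>x0\<close> in both ways stays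
      in the \<open>A\<close>-layer of \<open>x0\<close>.\<close>
    have "\<delta> \<in> ?W" "c \<in> ?U"
      using transport[OF x0 x0 z x0] transport[OF z x0 x0 x0] z \<psi>z by auto
    then show ?thesis
      using \<psi>z by force
  qed
  moreover have "?\<phi> (\<delta>, c) \<in> pverts A" if "\<delta> \<in> ?W" "c \<in> ?U" for \<delta> c
    using in_verts[of "(c, \<delta>)"] that by auto
  ultimately have "?\<phi> ` (?W \<times> ?U) = pverts A"
    by blast
  moreover have "(?\<phi> (\<delta>, c), ?\<phi> (\<delta>', c')) \<in> parcs A \<longleftrightarrow>
      ((\<delta>, c), (\<delta>', c')) \<in> parcs (induced D ?W \<box> induced C ?U)"
    if "\<delta> \<in> ?W" "c \<in> ?U" "\<delta>' \<in> ?W" "c' \<in> ?U" for \<delta> c \<delta>' c'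
  proof -
    have "(?\<phi> (\<delta>, c), ?\<phi> (\<delta>', c')) \<in> parcs A \<longleftrightarrow> (\<psi> (c, \<delta>), \<psi> (c', \<delta>')) \<in> parcs (A \<box> B)"
      using snd_eq[of \<delta> c] snd_eq[of \<delta>' c'] that in_verts[OF x0] pair_graph_arcD(3)[OF graphs(2)]
      by (auto simp: parcs_cartesian_product)
    also have "\<dots> \<longleftrightarrow> ((c, \<delta>), (c', \<delta>')) \<in> parcs (C \<box> D)"
      using that by (intro arcs) auto
    also have "\<dots> \<longleftrightarrow> ((\<delta>, c), (\<delta>', c')) \<in> parcs (induced D ?W \<box> induced C ?U)"
      using that by (auto simp: parcs_cartesian_product)
    finally show ?thesis .
  qed
  ultimately show ?thesis
    using inj_\<phi> unfolding graph_isomorphism_def bij_betw_def by simp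
qed

text \<open>Both graphs are the intersection of an \<open>A\<close>-layer with a
  \<open>D\<close>-layer, parametrized once by the \<open>D\<close>-coordinate and once by the
  \<open>A\<close>-coordinate. The second form is the one that \<open>layer_factorization\<close>
  yields for the inverse isomorphism.\<close>

lemma layer_intersection:
  assumes x0: "x0 \<in> pverts C \<times> pverts D"
  shows "graph_isomorphism (\<lambda>\<delta>. fst (\<psi> (fst x0, \<delta>)))
    (induced D {\<delta> \<in> pverts D. snd (\<psi> (fst x0, \<delta>)) = snd (\<psi> x0)})
    (induced A {a \<in> pverts A. fst (inv_into (pverts C \<times> pverts D) \<psi> (a, snd (\<psi> x0))) = fst x0})"
    (is "graph_isomorphism ?\<phi> (induced D ?W) (induced A ?W')")
proof -
  let ?inv = "inv_into (pverts C \<times> pverts D) \<psi>"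
  have inv_\<psi>: "?inv (\<psi> z) = z" if "z \<in> pverts C \<times> pverts D" for z
    using that inj by (intro inv_into_f_f inj_onI) auto
  have \<psi>W: "\<psi> (fst x0, \<delta>) = (?\<phi> \<delta>, snd (\<psi> x0))" "?\<phi> \<delta> \<in> ?W'" if "\<delta> \<in> ?W" for \<delta>
  proof -
    show eq: "\<psi> (fst x0, \<delta>) = (?\<phi> \<delta>, snd (\<psi> x0))"
      using that by (simp add: prod_eq_iff)
    have "?inv (\<psi> (fst x0, \<delta>)) = (fst x0, \<delta>)"
      using that x0 by (intro inv_\<psi>) auto
    then have "?inv (?\<phi> \<delta>, snd (\<psi> x0)) = (fst x0, \<delta>)"
      by (simp only: eq[symmetric])
    then show "?\<phi> \<delta> \<in> ?W'"
      using in_verts[of "(fst x0, \<delta>)"] that x0 by auto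
  qed
  have "inj_on ?\<phi> ?W"
  proof (rule inj_onI)
    fix \<delta> \<delta>' assume W: "\<delta> \<in> ?W" "\<delta>' \<in> ?W" and "?\<phi> \<delta> = ?\<phi> \<delta>'"
    then have "\<psi> (fst x0, \<delta>) = \<psi> (fst x0, \<delta>')"
      using \<psi>W(1)[of \<delta>] \<psi>W(1)[of \<delta>'] by simp
    then show "\<delta> = \<delta>'"
      using W x0 inj[of "(fst x0, \<delta>)" "(fst x0, \<delta>')"] by auto
  qed
  moreover have "a \<in> ?\<phi> ` ?W" if a: "a \<in> ?W'" for a
  proof -
    obtain z where z: "z \<in> pverts C \<times> pverts D" and \<psi>z: "\<psi> z = (a, snd (\<psi> x0))"
      by (rule surj[of "(a, snd (\<psi> x0))"]) (use a in_verts[OF x0] in auto)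
    then have "fst z = fst x0"
      using a inv_\<psi>[OF z] by simp
    then have "\<psi> (fst x0, snd z) = (a, snd (\<psi> x0))"
      using \<psi>z by (metis prod.collapse)
    then show ?thesis
      using z by force
  qed
  ultimately have "bij_betw ?\<phi> ?W ?W'"
    using \<psi>W(2) unfolding bij_betw_def by blast
  moreover have "(?\<phi> \<delta>, ?\<phi> \<delta>') \<in> parcs A \<longleftrightarrow> (\<delta>, \<delta>') \<in> parcs D" if W: "\<delta> \<in> ?W" "\<delta>' \<in> ?W" for \<delta> \<delta>'
  proof -
    have "(?\<phi> \<delta>, ?\<phi> \<delta>') \<in> parcs A \<longleftrightarrow> (\<psi> (fst x0, \<delta>), \<psi> (fst x0, \<delta>')) \<in> parcs (A \<box> B)"
      using W in_verts[OF x0] pair_graph_arcD(3)[OF graphs(2)] by (auto simp: parcs_cartesian_product)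
    also have "\<dots> \<longleftrightarrow> ((fst x0, \<delta>), (fst x0, \<delta>')) \<in> parcs (C \<box> D)"
      using W x0 by (intro arcs) auto
    also have "\<dots> \<longleftrightarrow> (\<delta>, \<delta>') \<in> parcs D"
      using x0 pair_graph_arcD(3)[OF graphs(3)] by (auto simp: parcs_cartesian_product)
    finally show ?thesis .
  qed
  ultimately show ?thesis
    using \<psi>W(2) unfolding graph_isomorphism_def by auto
qed

text \<open>The intersection \<open>?W\<close> of the \<open>A\<close>-layer and the
  \<open>D\<close>-layer through \<open>x0\<close> is a factor of \<open>A\<close>, and, through the
  inverse, of \<open>D\<close>. Relative primeness shrinks it to one vertex, so an
  \<open>A\<close>-layer stays within a single \<open>C\<close>-layer.\<close>

lemma relatively_prime_layers:
  assumes prime: "relatively_prime A D"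
    and x0: "x0 \<in> pverts C \<times> pverts D" and z: "z \<in> pverts C \<times> pverts D"
    and eq: "snd (\<psi> z) = snd (\<psi> x0)"
  shows "snd z = snd x0"
proof -
  let ?inv = "inv_into (pverts C \<times> pverts D) \<psi>"
  let ?W = "{\<delta> \<in> pverts D. snd (\<psi> (fst x0, \<delta>)) = snd (\<psi> x0)}"
  let ?U = "{c \<in> pverts C. snd (\<psi> (c, snd x0)) = snd (\<psi> x0)}"
  let ?W' = "{a \<in> pverts A. fst (?inv (a, snd (\<psi> x0))) = fst x0}"
  let ?V = "{b \<in> pverts B. fst (?inv (fst (\<psi> x0), b)) = fst x0}"
  have inv_x0: "?inv (\<psi> x0) = x0"
    using x0 inj by (intro inv_into_f_f inj_onI) auto
  interpret I: product_isomorphism C D A B ?inv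
    by (rule inverse)
  \<comment> \<open>In this arrangement it is \<open>D\<close> that factors, with sides
    \<open>?V\<close> in \<open>B\<close> and \<open>?W'\<close> in \<open>A\<close>; the latter is
    a copy of \<open>?W\<close> by \<open>layer_intersection\<close>.\<close>
  interpret J: product_isomorphism D C A B "prod.swap \<circ> ?inv"
    by (rule I.swap_codomain)
  have graph_W: "pair_graph (induced D ?W)"
    by (rule pair_graph_induced[OF graphs(4)]) auto
  obtain \<nu> and K :: "nat pair_pre_digraph" where K: "pair_graph K"
    and \<nu>: "graph_isomorphism \<nu> K (induced D ?W)"
    using pair_graph_nat_copy[OF graph_W] by blast
  have id: "graph_isomorphism id X X" for X :: "'x pair_pre_digraph"
    by (simp add: graph_isomorphism_def)
  have "pair_graph (induced C ?U)" "pair_graph (induced B ?V)"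
    using graphs by (auto intro: pair_graph_induced)
  then have "cartesian_factor K A" "cartesian_factor K D"
    using cartesian_factorI[OF graphs(1) K _
        graph_isomorphism_comp[OF graph_isomorphism_map_prod[OF \<nu> id] layer_factorization[OF x0]]]
      cartesian_factorI[OF graphs(4) K _ graph_isomorphism_comp[OF graph_isomorphism_comp[OF
          graph_isomorphism_map_prod[OF graph_isomorphism_comp[OF \<nu> layer_intersection[OF x0]] id]
          graph_isomorphism_swap] J.layer_factorization[OF in_verts[OF x0], simplified inv_x0 o_apply snd_swap]]]
    by blast+
  then have "card (pverts K) < 2"
    using prime unfolding relatively_prime_def by (meson not_le)
  moreover have "card (pverts K) = card ?W"
    using \<nu> by (auto simp: graph_isomorphism_def dest: bij_betw_same_card)
  ultimately have "card ?W \<le> Suc 0"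
    by simp
  moreover have "finite ?W"
    using pair_graph_finite[OF graphs(4)] by simp
  \<comment> \<open>By \<open>transport\<close>, the projection \<open>(fst x0, snd z)\<close> of
    \<open>z\<close> stays in the \<open>A\<close>-layer of \<open>x0\<close>.\<close>
  moreover have "snd x0 \<in> ?W" "snd z \<in> ?W"
    using x0 z transport[OF x0 x0 z x0] eq by auto
  ultimately show ?thesis
    using card_le_Suc0_iff_eq[of ?W] by blast
qed

end

text \<open>Take both decompositions to be \<open>H \<box> F\<close>. Applying
  \<open>relatively_prime_layers\<close> to \<open>\<sigma>\<close>, to its inverse and to their
  swapped forms shows that each coordinate of \<open>\<sigma> x\<close> determines, and is
  determined by, the same coordinate of \<open>x\<close>.\<close>

lemma cartesian_product_automorphism:
  assumes H: "pair_graph H" "connected (with_proj H)" and F: "pair_graph F" "connected (with_proj F)"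
    and prime: "relatively_prime H F" and \<sigma>: "graph_automorphism (H \<box> F) \<sigma>"
  obtains \<alpha> \<beta> where "graph_automorphism H \<alpha>" and "graph_automorphism F \<beta>"
    and "\<And>u f. u \<in> pverts H \<Longrightarrow> f \<in> pverts F \<Longrightarrow> \<sigma> (u, f) = (\<alpha> u, \<beta> f)"
proof -
  interpret P: product_isomorphism H F H F \<sigma>
    using H F \<sigma> by (simp add: product_isomorphism_def graph_automorphism_iff)
  interpret I: product_isomorphism H F H F "inv_into (pverts H \<times> pverts F) \<sigma>"
    by (rule P.inverse)
  have inv_\<sigma>: "inv_into (pverts H \<times> pverts F) \<sigma> (\<sigma> z) = z" if "z \<in> pverts H \<times> pverts F" for z
    using that P.inj by (intro inv_into_f_f inj_onI) auto
  interpret S: product_isomorphism F H F H "prod.swap \<circ> (\<sigma> \<circ> prod.swap)"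
    by (rule product_isomorphism.swap_codomain[OF P.swap_domain])
  interpret IS: product_isomorphism F H F H "prod.swap \<circ> (inv_into (pverts H \<times> pverts F) \<sigma> \<circ> prod.swap)"
    by (rule product_isomorphism.swap_codomain[OF I.swap_domain])
  have prime': "relatively_prime F H"
    using prime relatively_prime_commute by blast
  have snd_iff: "snd (\<sigma> x) = snd (\<sigma> y) \<longleftrightarrow> snd x = snd y"
    if "x \<in> pverts H \<times> pverts F" "y \<in> pverts H \<times> pverts F" for x y
    using P.relatively_prime_layers[OF prime that(2,1)]
      I.relatively_prime_layers[OF prime P.in_verts[OF that(2)] P.in_verts[OF that(1)]]
      inv_\<sigma>[OF that(1)] inv_\<sigma>[OF that(2)] by auto
  have fst_iff: "fst (\<sigma> x) = fst (\<sigma> y) \<longleftrightarrow> fst x = fst y"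
    if "x \<in> pverts H \<times> pverts F" "y \<in> pverts H \<times> pverts F" for x y
    using S.relatively_prime_layers[OF prime', of "prod.swap y" "prod.swap x"]
      IS.relatively_prime_layers[OF prime', of "prod.swap (\<sigma> y)" "prod.swap (\<sigma> x)"]
      inv_\<sigma>[OF that(1)] inv_\<sigma>[OF that(2)] P.in_verts[OF that(1)] P.in_verts[OF that(2)] that
    by (auto simp: mem_Times_iff)
  obtain u0 f0 where u0: "u0 \<in> pverts H" and f0: "f0 \<in> pverts F"
    using H F by (auto simp: connected_conv)
  define \<alpha> where "\<alpha> u = fst (\<sigma> (u, f0))" for u
  define \<beta> where "\<beta> f = snd (\<sigma> (u0, f))" for f
  have \<sigma>_eq: "\<sigma> (u, f) = (\<alpha> u, \<beta> f)" if "u \<in> pverts H" "f \<in> pverts F" for u f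
    unfolding \<alpha>_def \<beta>_def using fst_iff[of "(u, f)" "(u, f0)"] snd_iff[of "(u, f)" "(u0, f)"] that u0 f0
    by (simp add: prod_eq_iff)
  have \<alpha>_in: "\<alpha> u \<in> pverts H" if "u \<in> pverts H" for u
    using P.in_verts[of "(u, f0)"] that f0 by (auto simp: \<alpha>_def)
  have \<beta>_in: "\<beta> f \<in> pverts F" if "f \<in> pverts F" for f
    using P.in_verts[of "(u0, f)"] that u0 by (auto simp: \<beta>_def)
  have "inj_on \<alpha> (pverts H)"
    using fst_iff f0 by (auto intro!: inj_onI simp: \<alpha>_def)
  then have "bij_betw \<alpha> (pverts H) (pverts H)"
    using \<alpha>_in endo_inj_surj[OF pair_graph_finite[OF H(1)]] unfolding bij_betw_def by blast
  moreover have "(\<alpha> u, \<alpha> v) \<in> parcs H \<longleftrightarrow> (u, v) \<in> parcs H" if "u \<in> pverts H" "v \<in> pverts H" for u v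
    using P.arcs[of "(u, f0)" "(v, f0)"] that f0 \<beta>_in pair_graph_arcD(3)[OF F(1)]
    by (auto simp: \<sigma>_eq parcs_cartesian_product)
  ultimately have \<alpha>: "graph_automorphism H \<alpha>"
    by (simp add: graph_automorphism_def)
  have "inj_on \<beta> (pverts F)"
    using snd_iff u0 by (auto intro!: inj_onI simp: \<beta>_def)
  then have "bij_betw \<beta> (pverts F) (pverts F)"
    using \<beta>_in endo_inj_surj[OF pair_graph_finite[OF F(1)]] unfolding bij_betw_def by blast
  moreover have "(\<beta> f, \<beta> g) \<in> parcs F \<longleftrightarrow> (f, g) \<in> parcs F" if "f \<in> pverts F" "g \<in> pverts F" for f g
    using P.arcs[of "(u0, f)" "(u0, g)"] that u0 \<alpha>_in pair_graph_arcD(3)[OF H(1)]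
    by (auto simp: \<sigma>_eq parcs_cartesian_product)
  ultimately have "graph_automorphism F \<beta>"
    by (simp add: graph_automorphism_def)
  with \<alpha> \<sigma>_eq show thesis
    using that by blast
qed

section \<open>The pairing strategy\<close>

text \<open>Gentle always colors the mate of the vertex just colored by Rascal, so the colored
  vertices form whole pairs after each of Gentle's moves. Either member of a pair may have been
  colored first, hence the disjunction in \<open>win\<close>.\<close>

lemma winning_strategy_pairing:
  assumes "finite (pverts X)"
    and mate: "\<And>x. x \<in> pverts X \<Longrightarrow> mate x \<in> pverts X \<and> mate (mate x) = x \<and> mate x \<noteq> x"
    and resp: "\<And>x r. x \<in> pverts X \<Longrightarrow> r \<in> {1..N} \<Longrightarrow> resp x r \<in> {1..N}"
    and win: "\<And>c. c \<in> pverts X \<rightarrow> {1..N} \<Longrightarrow>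
      (\<And>x. x \<in> pverts X \<Longrightarrow> c (mate x) = resp x (c x) \<or> c x = resp (mate x) (c (mate x))) \<Longrightarrow>
      distinguishing X c"
  shows "\<exists>s. winning_strategy X N s"
proof -
  define s where "s p = (mate (fst (last p)), resp (fst (last p)) (snd (last p)))" for p
  have s_take: "s (take k p) = (mate (fst (p ! (k - 1))), resp (fst (p ! (k - 1))) (snd (p ! (k - 1))))"
    if "odd k" "k \<le> length p" for k p
  proof -
    have "take k p \<noteq> []" and "k - 1 < k"
      using that odd_pos by auto
    then have "last (take k p) = p ! (k - 1)"
      using that by (simp add: last_conv_nth min_absorb2)
    then show ?thesis
      by (simp add: s_def)
  qed
  have gentle: "p ! k = (mate (fst (p ! (k - 1))), resp (fst (p ! (k - 1))) (snd (p ! (k - 1))))"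
    if "follows_strategy s p" "odd k" "k < length p" for p k
    using that s_take[of k p] by (simp add: follows_strategy_def)
  have move: "fst (p ! k) \<in> pverts X" "snd (p ! k) \<in> {1..N}" if "legal_play X N p" "k < length p" for p k
  proof -
    have "p ! k \<in> pverts X \<times> {1..N}"
      using that nth_mem unfolding legal_play_def by blast
    then show "fst (p ! k) \<in> pverts X" "snd (p ! k) \<in> {1..N}"
      by (auto simp: mem_Times_iff)
  qed
  have same: "i = j" if "legal_play X N p" "i < length p" "j < length p" "fst (p ! i) = fst (p ! j)" for p i j
    using that nth_eq_iff_index_eq[of "map fst p" i j] by (simp add: legal_play_def)
  have legal: "legal_play X N (p @ [s p])"
    if p: "legal_play X N p" "follows_strategy s p" "odd (length p)" for p
  proof -
    define l where "l = length p - 1"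
    have l: "l < length p" "even l" "length p = Suc l"
      using that(3) odd_pos[OF that(3)] by (auto simp: l_def)
    define x where "x = fst (p ! l)"
    have x: "x \<in> pverts X"
      using move[OF p(1) l(1)] by (simp add: x_def)
    have sp: "s p = (mate x, resp x (snd (p ! l)))"
      using s_take[OF p(3) order_refl] by (simp add: x_def l_def)
    \<comment> \<open>An earlier visit to \<open>mate x\<close> at an even position would have been
      answered by \<open>x\<close>; one at an odd position would itself have answered
      \<open>x\<close>. Either way \<open>x\<close> would occur before position
      \<open>l\<close>.\<close>
    have "mate x \<notin> set (map fst p)"
    proof
      assume "mate x \<in> set (map fst p)"
      then obtain j where j: "j < length p" "fst (p ! j) = mate x"
        by (auto simp: in_set_conv_nth)
      show False
      proof (cases "even j")
        case True
        have "j \<noteq> l"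
          using j(2) mate[OF x] by (auto simp: x_def)
        then have "j + 1 < l"
          using True l j(1) by presburger
        moreover from this have "fst (p ! (j + 1)) = mate (mate x)"
          using gentle[OF p(2), of "j + 1"] True l(3) j(2) by simp
        ultimately show False
          using same[OF p(1), of "j + 1" l] mate[OF x] l by (simp add: x_def)
      next
        case False
        then have "mate (fst (p ! (j - 1))) = mate x"
          using gentle[OF p(2) False j(1)] j(2) by simp
        moreover have j': "j - 1 < l"
          using j(1) l False odd_pos[OF False] by presburger
        ultimately have "fst (p ! (j - 1)) = x"
          using mate[OF x] mate[OF move(1)[OF p(1), of "j - 1"]] l by auto
        then show False
          using same[OF p(1), of "j - 1" l] j' l by (simp add: x_def)
      qed
    qed
    then show ?thesis
      using p(1) mate[OF x] resp[OF x move(2)[OF p(1) l(1)]] by (simp add: legal_play_def sp)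
  qed
  have dist: "distinguishing X (\<lambda>u. the (map_of p u))"
    if p: "legal_play X N p" "follows_strategy s p" "length p = card (pverts X)" for p
  proof (rule win)
    have d: "distinct (map fst p)"
      using p(1) by (simp add: legal_play_def)
    have color: "the (map_of p (fst (p ! i))) = snd (p ! i)" if "i < length p" for i
      using map_of_is_SomeI[OF d, of "fst (p ! i)" "snd (p ! i)"] nth_mem[OF that] by simp
    have "set (map fst p) \<subseteq> pverts X"
      using p(1) by (auto simp: legal_play_def)
    moreover have "card (set (map fst p)) = card (pverts X)"
      using distinct_card[OF d] p(3) by simp
    ultimately have all: "set (map fst p) = pverts X"
      using card_subset_eq[OF assms(1)] by blast
    have index: "\<exists>i<length p. fst (p ! i) = x" if "x \<in> pverts X" for x
      using that unfolding all[symmetric] by (metis in_set_conv_nth length_map nth_map)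
    \<comment> \<open>After an odd number of moves Gentle's answer would be legal, although every
      vertex is already colored.\<close>
    have even_card: "even (length p)"
    proof (rule ccontr)
      assume "odd (length p)"
      then have "legal_play X N (p @ [s p])"
        using legal p by blast
      then have "fst (s p) \<in> pverts X" "fst (s p) \<notin> set (map fst p)"
        by (auto simp: legal_play_def)
      then show False
        using all by simp
    qed
    show "(\<lambda>u. the (map_of p u)) \<in> pverts X \<rightarrow> {1..N}"
    proof
      fix x assume "x \<in> pverts X"
      then obtain i where "i < length p" "fst (p ! i) = x"
        using index by blast
      then show "the (map_of p x) \<in> {1..N}"
        using color[of i] move(2)[OF p(1), of i] by auto
    qed
    fix x assume x: "x \<in> pverts X"
    then obtain i where i: "i < length p" "fst (p ! i) = x"
      using index by blast
    show "the (map_of p (mate x)) = resp x (the (map_of p x)) \<or>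
          the (map_of p x) = resp (mate x) (the (map_of p (mate x)))"
    proof (cases "even i")
      case True
      then have "i + 1 < length p"
        using i even_card by presburger
      then show ?thesis
        using gentle[OF p(2), of "i + 1"] True color[of "i + 1"] color[of i] i by auto
    next
      case False
      have i': "i - 1 < length p"
        using i by simp
      have "p ! i = (mate (fst (p ! (i - 1))), resp (fst (p ! (i - 1))) (snd (p ! (i - 1))))"
        using gentle[OF p(2) False i(1)] .
      moreover from this have "fst (p ! (i - 1)) = mate x"
        using i(2) mate[OF move(1)[OF p(1) i']] by auto
      ultimately show ?thesis
        using color[OF i'] color[OF i(1)] i(2) by simp
    qed
  qed
  show ?thesis
    unfolding winning_strategy_def using legal dist by blast
qed

section \<open>Encoding pairs of elements of \<open>{1..d}\<close> by pairs of game colors\<close>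

lemma card_sorted_pairs: "2 * card {(i, j). 1 \<le> i \<and> i \<le> j \<and> j \<le> d} = d ^ 2 + (d :: nat)"
proof -
  have "{(i, j). 1 \<le> i \<and> i \<le> j \<and> j \<le> d} = prod.swap ` (SIGMA j:{1..d}. {1..j})"
    by (auto simp: image_iff)
  then have "card {(i, j). 1 \<le> i \<and> i \<le> j \<and> j \<le> d} = (\<Sum>j=1..d. j)"
    by (simp add: card_image)
  then show ?thesis
    using double_gauss_sum_from_Suc_0[of d, where 'a = nat] by (simp add: power2_eq_square)
qed

text \<open>
  Identify the \<open>d\<^sup>2 + d - 2\<close> colors with the residues modulo that even number. The residues
  fixed by negation, \<open>0\<close> and \<open>(d\<^sup>2 + d - 2) / 2\<close>, encode the pairs \<open>(1, 1)\<close> and \<open>(2, 2)\<close>; the pairs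
  \<open>{x, -x}\<close> of the others encode the remaining unordered pairs of elements of \<open>{1..d}\<close>. An ordered
  pair of colors \<open>(r, s)\<close> then encodes what \<open>s - r\<close> encodes.
\<close>

lemma ex_response_table:
  fixes d :: nat
  assumes "d \<ge> 2"
  shows "\<exists>g :: nat \<Rightarrow> nat \<Rightarrow> nat \<times> nat. (\<forall>r s. g s r = prod.swap (g r s)) \<and>
    (\<forall>r\<in>{1..d^2 + d - 2}. \<forall>i\<in>{1..d}. \<forall>j\<in>{1..d}. \<exists>s\<in>{1..d^2 + d - 2}. g r s = (i, j))"
proof -
  let ?P = "{(i, j). 1 \<le> i \<and> i \<le> j \<and> j \<le> d}"
  \<comment> \<open>Setting two pairs aside leaves \<open>M - 1\<close> sorted pairs, matched with
    the residues \<open>1\<close> to \<open>M - 1\<close>; the modulus \<open>2 * M\<close> is then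
    exactly \<open>d^2 + d - 2\<close>.\<close>
  define M where "M = card ?P - 1"
  define N where "N = 2 * int M"
  have "?P \<subseteq> {1..d} \<times> {1..d}"
    by auto
  then have fin: "finite ?P"
    using finite_subset by blast
  have "d ^ 2 + d \<ge> 6"
    using assms mult_mono[OF assms assms] by (simp add: power2_eq_square)
  then have M: "M \<ge> 2" and "2 * M = d ^ 2 + d - 2"
    using card_sorted_pairs[of d] by (simp_all add: M_def)
  from this(2) have N: "N = int (d ^ 2 + d - 2)"
    by (simp add: N_def flip: of_nat_mult)
  have "(1, 1) \<in> ?P" "(2, 2) \<in> ?P"
    using assms by auto
  then have "card (?P - {(1, 1), (2, 2)}) = M - 1"
    using fin by (simp add: M_def card_Diff_subset)
  then have "card {1..<int M} = card (?P - {(1, 1), (2, 2)})"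
    by simp
  then obtain e where e: "bij_betw e {1..<int M} (?P - {(1, 1), (2, 2)})"
    using finite_same_card_bij[OF finite_atLeastLessThan_int finite_Diff[OF fin]] by blast
  \<comment> \<open>Residues above \<open>M\<close> carry the reversed pair of their negative, and
    \<open>0\<close> and \<open>M\<close> carry pairs with equal entries, so negation acts as
    \<open>prod.swap\<close>.\<close>
  define h where "h x = (if x = 0 then (1, 1) else if x = int M then (2, 2)
    else if x < int M then e x else prod.swap (e (N - x)))" for x
  define g where "g r s = h ((int s - int r) mod N)" for r s
  have Npos: "N > 0"
    using M by (simp add: N_def)
  have h_minus: "h (- x mod N) = prod.swap (h (x mod N))" for x
  proof -
    define y where "y = x mod N"
    have "0 \<le> y" "y < N"
      using Npos by (simp_all add: y_def)
    moreover have "- x mod N = (if y = 0 then 0 else N - y)"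
      by (simp add: zmod_zminus1_eq_if y_def)
    ultimately show ?thesis
      using M unfolding y_def[symmetric] by (auto simp: h_def N_def)
  qed
  have "g s r = prod.swap (g r s)" for r s
    using h_minus[of "int s - int r"] by (simp add: g_def)
  moreover have "\<exists>s\<in>{1..d^2 + d - 2}. g r s = (i, j)"
    if r: "r \<in> {1..d^2 + d - 2}" and i: "i \<in> {1..d}" and j: "j \<in> {1..d}" for r i j
  proof -
    have sorted: "\<exists>x\<in>{0..<N}. h x = (k, l)" if "1 \<le> k" "k \<le> l" "l \<le> d" for k l
    proof -
      have "(k, l) \<in> ?P"
        using that by simp
      then consider "(k, l) = (1, 1)" | "(k, l) = (2, 2)" | "(k, l) \<in> e ` {1..<int M}"
        using bij_betw_imp_surj_on[OF e] by blast
      then show ?thesis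
      proof cases
        case 1
        then show ?thesis
          using Npos by (intro bexI[of _ 0]) (auto simp: h_def)
      next
        case 2
        then show ?thesis
          using M by (intro bexI[of _ "int M"]) (auto simp: h_def N_def)
      next
        case 3
        then obtain x where "x \<in> {1..<int M}" "e x = (k, l)"
          by force
        then show ?thesis
          by (intro bexI[of _ x]) (auto simp: h_def N_def)
      qed
    qed
    have "\<exists>x\<in>{0..<N}. h x = (i, j)"
    proof (cases "i \<le> j")
      case True
      then show ?thesis
        using sorted i j by auto
    next
      case False
      then obtain x where x: "x \<in> {0..<N}" "h x = (j, i)"
        using sorted[of j i] i j by auto
      then have "h (- x mod N) = (i, j)"
        using h_minus[of x] by simp
      then show ?thesis
        using Npos by (intro bexI[of _ "- x mod N"]) auto
    qed
    then obtain x where x: "x \<in> {0..<N}" "h x = (i, j)"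
      by blast
    \<comment> \<open>The color congruent to \<open>r + x\<close> modulo \<open>N\<close>; the shift
      by one selects the representative in \<open>{1..N}\<close> rather than in
      \<open>{0..N - 1}\<close>.\<close>
    define s where "s = nat ((int r + x - 1) mod N + 1)"
    have range: "0 \<le> (int r + x - 1) mod N" "(int r + x - 1) mod N < N"
      using Npos by simp_all
    then have "(int s - int r) mod N = ((int r + x - 1) mod N + (1 - int r)) mod N"
      by (simp add: s_def algebra_simps)
    also have "\<dots> = x"
      using x(1) by (simp add: mod_add_left_eq)
    finally have "g r s = (i, j)"
      using x(2) by (simp add: g_def)
    moreover have "s \<in> {1..nat N}"
      using range unfolding s_def by auto
    then have "s \<in> {1..d^2 + d - 2}"
      unfolding N by simp
    ultimately show ?thesis
      by blast
  qed
  ultimately show ?thesis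
    by blast
qed

section \<open>Colorings with prescribed profiles\<close>

text \<open>Turns a list of multiplicities into an assignment of pair types to orbit
  representatives. The first fibre is an arbitrary subset of the right size, and the rest is split
  by induction.\<close>

lemma ex_function_with_fibre_cards:
  assumes "finite R" and "sum_list l = card R"
  shows "\<exists>w. (\<forall>u\<in>R. w u < length l) \<and> (\<forall>k<length l. card {u \<in> R. w u = k} = l ! k)"
  using assms
proof (induction l arbitrary: R)
  case Nil
  then show ?case by simp
next
  case (Cons a l)
  have "a \<le> card R"
    using Cons.prems(2) by simp
  then obtain S where S: "S \<subseteq> R" "card S = a" "finite S"
    by (rule obtain_subset_with_card_n)
  have "finite (R - S)" "sum_list l = card (R - S)"
    using Cons.prems S by (simp_all add: card_Diff_subset)
  from Cons.IH[OF this] obtain w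
    where w: "\<forall>u\<in>R - S. w u < length l" "\<forall>k<length l. card {u \<in> R - S. w u = k} = l ! k"
    by blast
  define w' where "w' u = (if u \<in> S then 0 else Suc (w u))" for u
  have "{u \<in> R. w' u = 0} = S" "{u \<in> R. w' u = Suc k} = {u \<in> R - S. w u = k}" for k
    using S(1) by (auto simp: w'_def)
  then have "card {u \<in> R. w' u = k} = (a # l) ! k" if "k < length (a # l)" for k
    using that w(2) S(2) by (cases k) simp_all
  moreover have "w' u < length (a # l)" if "u \<in> R" for u
    using that w(1) by (simp add: w'_def)
  ultimately show ?case
    by blast
qed

lemma involution_representatives:
  assumes "finite V" and inv: "\<And>u. u \<in> V \<Longrightarrow> bar u \<in> V \<and> bar (bar u) = u \<and> bar u \<noteq> u"
  obtains R where "R \<inter> bar ` R = {}" and "R \<union> bar ` R = V"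
proof -
  obtain h :: "'a \<Rightarrow> nat" where h: "inj_on h V"
    using finite_imp_inj_to_nat_seg[OF assms(1)] by blast
  \<comment> \<open>Each orbit \<open>{u, bar u}\<close> contributes its member with the smaller
    number under \<open>h\<close>.\<close>
  define R where "R = {u \<in> V. h u < h (bar u)}"
  have "u \<in> bar ` R" if "u \<in> V" "u \<notin> R" for u
  proof -
    have "h (bar u) \<noteq> h u"
      using inj_onD[OF h] inv[OF that(1)] that(1) by blast
    then have "bar u \<in> R"
      using that inv[OF that(1)] by (auto simp: R_def)
    then show ?thesis
      using inv[OF that(1)] by force
  qed
  moreover have "bar u \<in> V - R" if "u \<in> R" for u
    using that inv[of u] by (auto simp: R_def)
  ultimately have "R \<inter> bar ` R = {}" "R \<union> bar ` R = V"
    unfolding R_def by blast+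
  then show thesis
    by (rule that)
qed

text \<open>Sorting the two colors makes the value the same at \<open>u\<close> and
  \<open>bar u\<close>.\<close>

definition unordered_pair :: "('v \<Rightarrow> 'v) \<Rightarrow> ('v \<Rightarrow> nat) \<Rightarrow> 'v \<Rightarrow> nat \<times> nat" where
  "unordered_pair bar c u = (min (c u) (c (bar u)), max (c u) (c (bar u)))"

text \<open>The \<open>n / 2\<close> orbits of \<open>bar\<close> receive unordered pairs of
  \<open>t = (d^2 + d) / 2\<close> types, and only multiplicities are compared. Stars and bars gives
  \<open>(n / 2 + t - 1) choose (t - 1)\<close> profiles, the bound on \<open>D\<close>. The index
  \<open>k0\<close> is reserved for \<open>c\<close>, so that one layer can later distinguish
  \<open>H\<close>.\<close>

lemma ex_profile_coloring:
  fixes bar :: "'v \<Rightarrow> 'v" and d n D k0 :: nat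
  assumes "finite V" and inv: "\<And>u. u \<in> V \<Longrightarrow> bar u \<in> V \<and> bar (bar u) = u \<and> bar u \<noteq> u"
    and n: "card V = n" and c: "c \<in> V \<rightarrow> {1..d}" and "d \<ge> 1"
    and D: "D \<le> ((n + d^2 + d) div 2 - 1) choose ((d^2 + d) div 2 - 1)"
    and k0: "k0 \<in> {1..D}"
  shows "\<exists>\<chi> :: nat \<Rightarrow> 'v \<Rightarrow> nat. \<chi> k0 = c \<and> (\<forall>k\<in>{1..D}. \<chi> k \<in> V \<rightarrow> {1..d}) \<and>
    inj_on (\<lambda>k p. card {u \<in> V. unordered_pair bar (\<chi> k) u = p}) {1..D}"
proof -
  let ?P = "{(i, j). 1 \<le> i \<and> i \<le> j \<and> j \<le> d}"
  define t where "t = card ?P"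
  have "?P \<subseteq> {1..d} \<times> {1..d}"
    by auto
  then have finP: "finite ?P"
    using finite_subset by blast
  have t: "2 * t = d^2 + d" "t \<ge> 1"
    using card_sorted_pairs[of d] \<open>d \<ge> 1\<close> by (auto simp: t_def)
  obtain e where e: "bij_betw e {0..<t} ?P"
    using ex_bij_betw_nat_finite[OF finP] unfolding t_def by blast
  obtain R where R: "R \<inter> bar ` R = {}" "R \<union> bar ` R = V"
    using involution_representatives[OF assms(1) inv] by blast
  have finR: "finite R"
    using R(2) assms(1) finite_subset by blast
  have inj_bar: "inj_on bar S" if "S \<subseteq> V" for S
    using inv that by (metis inj_onI subsetD)
  \<comment> \<open>A \<open>bar\<close>-invariant property holds at both members of an orbit or at
    neither, so counting over \<open>V\<close> doubles the count over representatives.\<close>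
  have card2: "card {u \<in> V. Q u} = 2 * card {u \<in> R. Q u}" if "\<And>u. u \<in> V \<Longrightarrow> Q (bar u) = Q u" for Q
  proof -
    have "{u \<in> V. Q u} = {u \<in> R. Q u} \<union> bar ` {u \<in> R. Q u}"
      using R(2) that by auto
    moreover have "{u \<in> R. Q u} \<inter> bar ` {u \<in> R. Q u} = {}"
      using R(1) by blast
    moreover have "card (bar ` {u \<in> R. Q u}) = card {u \<in> R. Q u}"
      using R(2) by (intro card_image inj_bar) auto
    ultimately show ?thesis
      using finR by (simp add: card_Un_disjoint)
  qed
  have card_R: "n = 2 * card R"
    using card2[of "\<lambda>_. True"] n by simp
  define \<tau> where "\<tau> \<chi> = map (\<lambda>k. card {u \<in> R. unordered_pair bar \<chi> u = e k}) [0..<t]" for \<chi>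
  define L where "L = {l. length l = t \<and> sum_list l = card R}"
  have up_bar: "unordered_pair bar \<chi> (bar u) = unordered_pair bar \<chi> u" if "u \<in> V" for \<chi> u
    using inv[OF that] by (simp add: unordered_pair_def min.commute max.commute)
  have pair_P: "unordered_pair bar \<chi> u \<in> ?P" if "\<chi> \<in> V \<rightarrow> {1..d}" "u \<in> V" for \<chi> u
    using that(1) that(2) inv[OF that(2)] by (auto simp: unordered_pair_def Pi_iff)
  have \<tau>_L: "\<tau> \<chi> \<in> L" if \<chi>: "\<chi> \<in> V \<rightarrow> {1..d}" for \<chi>
  proof -
    have "sum_list (\<tau> \<chi>) = (\<Sum>k\<in>{0..<t}. card {u \<in> R. unordered_pair bar \<chi> u = e k})"
      by (simp add: \<tau>_def sum_list_distinct_conv_sum_set)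
    also have "\<dots> = (\<Sum>p\<in>?P. card {u \<in> R. unordered_pair bar \<chi> u = p})"
      by (rule sum.reindex_bij_betw[OF e])
    also have "\<dots> = card R"
      using pair_P[OF \<chi>] R(2) finR finP
      by (subst card_UN_disjoint[symmetric]) (auto intro!: arg_cong[where f = card])
    finally show ?thesis
      by (simp add: L_def \<tau>_def)
  qed
  have realize: "\<exists>\<chi>. \<chi> \<in> V \<rightarrow> {1..d} \<and> \<tau> \<chi> = l" if "l \<in> L" for l
  proof -
    obtain w where w: "\<forall>u\<in>R. w u < length l" "\<forall>k<length l. card {u \<in> R. w u = k} = l ! k"
      using ex_function_with_fibre_cards[OF finR, of l] \<open>l \<in> L\<close> by (auto simp: L_def)
    \<comment> \<open>A representative takes the first entry of its assigned pair and its partner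
      takes the second.\<close>
    define \<chi> where "\<chi> u = (if u \<in> R then fst (e (w u)) else snd (e (w (bar u))))" for u
    have eP: "e (w u) \<in> ?P" if "u \<in> R" for u
    proof -
      have "w u \<in> {0..<t}"
        using that w(1) \<open>l \<in> L\<close> by (simp add: L_def)
      then show ?thesis
        by (rule bspec[OF bij_betwE[OF e]])
    qed
    have "\<chi> u \<in> {1..d}" if u: "u \<in> V" for u
    proof (cases "u \<in> R")
      case True
      then show ?thesis
        using eP[OF True] by (auto simp: \<chi>_def)
    next
      case False
      then have "bar u \<in> R"
        using u R(2) inv by auto
      then show ?thesis
        using eP[of "bar u"] False by (auto simp: \<chi>_def)
    qed
    moreover have "unordered_pair bar \<chi> u = e (w u)" if "u \<in> R" for u
    proof -
      have "bar u \<notin> R" "bar (bar u) = u"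
        using that R inv by blast+
      then show ?thesis
        using that eP[OF that] by (auto simp: unordered_pair_def \<chi>_def)
    qed
    then have "card {u \<in> R. unordered_pair bar \<chi> u = e k} = l ! k" if "k < t" for k
    proof -
      have "e (w u) = e k \<longleftrightarrow> w u = k" if "u \<in> R" for u
        using e w(1) \<open>l \<in> L\<close> \<open>k < t\<close> that by (auto simp: bij_betw_def L_def dest: inj_onD)
      then have "{u \<in> R. unordered_pair bar \<chi> u = e k} = {u \<in> R. w u = k}"
        using \<open>\<And>u. u \<in> R \<Longrightarrow> unordered_pair bar \<chi> u = e (w u)\<close> by auto
      then show ?thesis
        using w(2) \<open>l \<in> L\<close> that by (simp add: L_def)
    qed
    then have "\<tau> \<chi> = l"
      using \<open>l \<in> L\<close> by (intro nth_equalityI) (auto simp: \<tau>_def L_def)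
    ultimately show ?thesis
      by blast
  qed
  have "card L = (card R + t - 1) choose card R"
    unfolding L_def by (rule card_length_sum_list)
  also have "\<dots> = (card R + t - 1) choose (t - 1)"
    using t(2) by (subst binomial_symmetric) auto
  also have "\<dots> = ((n + d^2 + d) div 2 - 1) choose ((d^2 + d) div 2 - 1)"
    using card_R t(1) by (simp flip: t(1) add: add.assoc)
  finally have card_L: "D \<le> card L"
    using D by simp
  \<comment> \<open>Infinite sets have cardinality 0, so a positive cardinality gives
    finiteness.\<close>
  then have "card L > 0"
    using k0 by simp
  then have finL: "finite L"
    by (rule card_ge_0_finite)
  \<comment> \<open>The profile of \<open>c\<close> belongs to \<open>k0\<close>; the other indices
    are injected into the remaining profiles.\<close>
  have "card ({1..D} - {k0}) \<le> card (L - {\<tau> c})"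
    using card_L k0 \<tau>_L[OF c] finL by simp
  then obtain \<phi> where \<phi>: "\<phi> ` ({1..D} - {k0}) \<subseteq> L - {\<tau> c}" "inj_on \<phi> ({1..D} - {k0})"
    using card_le_inj[of "{1..D} - {k0}" "L - {\<tau> c}"] finL by auto
  have "\<exists>\<chi>. \<chi> \<in> V \<rightarrow> {1..d} \<and> \<tau> \<chi> = (\<phi>(k0 := \<tau> c)) k \<and> (k = k0 \<longrightarrow> \<chi> = c)" if "k \<in> {1..D}" for k
  proof (cases "k = k0")
    case True
    then show ?thesis
      using c by auto
  next
    case False
    then have "\<phi> k \<in> L"
      using \<phi>(1) that by blast
    then show ?thesis
      using realize False by simp
  qed
  then obtain \<chi> where \<chi>: "\<chi> k \<in> V \<rightarrow> {1..d}" "\<tau> (\<chi> k) = (\<phi>(k0 := \<tau> c)) k" "k = k0 \<longrightarrow> \<chi> k = c"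
    if "k \<in> {1..D}" for k
    by metis
  have "inj_on (\<lambda>k p. card {u \<in> V. unordered_pair bar (\<chi> k) u = p}) {1..D}"
  proof (rule inj_onI)
    fix k l assume k: "k \<in> {1..D}" and l: "l \<in> {1..D}"
      and "(\<lambda>p. card {u \<in> V. unordered_pair bar (\<chi> k) u = p}) = (\<lambda>p. card {u \<in> V. unordered_pair bar (\<chi> l) u = p})"
    then have "card {u \<in> V. unordered_pair bar (\<chi> k) u = p} = card {u \<in> V. unordered_pair bar (\<chi> l) u = p}" for p
      by meson
    then have "card {u \<in> R. unordered_pair bar (\<chi> k) u = p} = card {u \<in> R. unordered_pair bar (\<chi> l) u = p}" for p
      using card2[of "\<lambda>u. unordered_pair bar (\<chi> k) u = p"] card2[of "\<lambda>u. unordered_pair bar (\<chi> l) u = p"]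
      by (simp add: up_bar)
    then have "\<tau> (\<chi> k) = \<tau> (\<chi> l)"
      by (simp add: \<tau>_def)
    then have eq: "(\<phi>(k0 := \<tau> c)) k = (\<phi>(k0 := \<tau> c)) l"
      using \<chi>(2)[OF k] \<chi>(2)[OF l] by simp
    have "\<phi> i \<noteq> \<tau> c" if "i \<in> {1..D} - {k0}" for i
      using \<phi>(1) that by blast
    then show "k = l"
      using eq k l inj_onD[OF \<phi>(2), of k l] by (auto split: if_splits)
  qed
  moreover have "\<chi> k0 = c"
    using \<chi>(3)[OF k0] by simp
  ultimately show ?thesis
    using \<chi>(1) by (intro exI[of _ \<chi>] conjI ballI)
qed

section \<open>The distinguishing game on the product\<close>

text \<open>An injective coloring is distinguishing, so the \<open>LEAST\<close> in
  \<open>distinguishing_number\<close> is attained.\<close>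

lemma distinguishing_coloring_exists:
  assumes "pair_graph X"
  obtains c where "c \<in> pverts X \<rightarrow> {1..distinguishing_number X}" and "distinguishing X c"
proof -
  obtain h where h: "bij_betw h (pverts X) {0..<card (pverts X)}"
    using ex_bij_betw_finite_nat[OF pair_graph_finite[OF assms]] by blast
  have "Suc \<circ> h \<in> pverts X \<rightarrow> {1..card (pverts X)}"
    using bij_betwE[OF h] by (force simp: Suc_le_eq)
  moreover have "distinguishing X (Suc \<circ> h)"
    unfolding distinguishing_def
  proof (intro allI impI ballI)
    fix \<sigma> u assume \<sigma>: "graph_automorphism X \<sigma> \<and> (\<forall>u\<in>pverts X. (Suc \<circ> h) (\<sigma> u) = (Suc \<circ> h) u)"
      and u: "u \<in> pverts X"
    then have "\<sigma> u \<in> pverts X"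
      by (auto simp: graph_automorphism_def dest: bij_betwE)
    then show "\<sigma> u = u"
      using \<sigma> u bij_betw_imp_inj_on[OF h] by (auto dest: inj_onD)
  qed
  ultimately have "\<exists>c. c \<in> pverts X \<rightarrow> {1..distinguishing_number X} \<and> distinguishing X c"
    unfolding distinguishing_number_def
    by (intro LeastI_ex[of "\<lambda>d. \<exists>c. c \<in> pverts X \<rightarrow> {1..d} \<and> distinguishing X c"] exI conjI)
  then show thesis
    using that by blast
qed

theorem theorem1p5:
  fixes H :: "'a pair_pre_digraph" and F :: "'b pair_pre_digraph"
    and bar :: "'a \<Rightarrow> 'a" and n d :: nat
  assumes "involutive_graph H bar"
    and "connected (with_proj H)"
    and "card (pverts H) = n"
    and "d = distinguishing_number H"
    and "d \<ge> 2"
    and "pair_graph F"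
    and "connected (with_proj F)"
    and "relatively_prime H F"
    and "distinguishing_number F \<le> ((n + d^2 + d) div 2 - 1) choose ((d^2 + d) div 2 - 1)"
  shows "rascal_distinguishing_number (H \<box> F) \<le> enat (d^2 + d - 2)"
proof -
  define N where "N = d^2 + d - 2"
  have H: "pair_graph H"
    using assms(1) by (simp add: involutive_graph_def)
  have bar: "bar u \<in> pverts H \<and> bar (bar u) = u \<and> bar u \<noteq> u" if "u \<in> pverts H" for u
    using assms(1) that by (auto simp: involutive_graph_def)
  have bar_aut: "\<alpha> (bar u) = bar (\<alpha> u)" if "graph_automorphism H \<alpha>" "u \<in> pverts H" for \<alpha> u
    using assms(1) that by (auto simp: involutive_graph_def)
  obtain c where c: "c \<in> pverts H \<rightarrow> {1..d}" and dist_c: "distinguishing H c"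
    using distinguishing_coloring_exists[OF H] unfolding assms(4) by blast
  obtain cF where cF: "cF \<in> pverts F \<rightarrow> {1..distinguishing_number F}" and dist_cF: "distinguishing F cF"
    using distinguishing_coloring_exists[OF assms(6)] by blast
  obtain f0 where f0: "f0 \<in> pverts F"
    using assms(7) by (auto simp: connected_conv)
  have "1 \<le> d"
    using assms(5) by simp
  moreover have "cF f0 \<in> {1..distinguishing_number F}"
    using cF f0 by blast
  ultimately obtain \<chi> where \<chi>0: "\<chi> (cF f0) = c"
    and \<chi>: "\<And>k. k \<in> {1..distinguishing_number F} \<Longrightarrow> \<chi> k \<in> pverts H \<rightarrow> {1..d}"
    and \<chi>_inj: "inj_on (\<lambda>k p. card {u \<in> pverts H. unordered_pair bar (\<chi> k) u = p}) {1..distinguishing_number F}"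
    using ex_profile_coloring[OF pair_graph_finite[OF H] bar assms(3) c _ assms(9)] by blast
  obtain g :: "nat \<Rightarrow> nat \<Rightarrow> nat \<times> nat" where g_swap: "\<And>r s. g s r = prod.swap (g r s)"
    and g_surj: "\<And>r i j. r \<in> {1..N} \<Longrightarrow> i \<in> {1..d} \<Longrightarrow> j \<in> {1..d} \<Longrightarrow> \<exists>s\<in>{1..N}. g r s = (i, j)"
    using ex_response_table[OF assms(5)] unfolding N_def by metis
  \<comment> \<open>The coloring that Gentle aims to encode in the layer over \<open>f\<close>; over
    \<open>f0\<close> it is \<open>c\<close>.\<close>
  define cf where "cf f = \<chi> (cF f)" for f
  have cf: "cf f u \<in> {1..d}" if "f \<in> pverts F" "u \<in> pverts H" for f u
    using \<chi>[of "cF f"] cF that by (auto simp: cf_def Pi_iff)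
  define mate where "mate = (\<lambda>x :: 'a \<times> 'b. (bar (fst x), snd x))"
  define resp where "resp = (\<lambda>x r. SOME s. s \<in> {1..N} \<and>
    g r s = (cf (snd x) (fst x), cf (snd x) (bar (fst x))))"
  have resp: "resp x r \<in> {1..N} \<and> g r (resp x r) = (cf (snd x) (fst x), cf (snd x) (bar (fst x)))"
    if "x \<in> pverts (H \<box> F)" "r \<in> {1..N}" for x r
  proof -
    have "cf (snd x) (fst x) \<in> {1..d}" "cf (snd x) (bar (fst x)) \<in> {1..d}"
      using that(1) cf bar by auto
    from g_surj[OF that(2) this] show ?thesis
      unfolding resp_def Bex_def by (rule someI_ex)
  qed
  have finite: "finite (pverts (H \<box> F))"
    using pair_graph_finite[OF H] pair_graph_finite[OF assms(6)] by simp
  have "\<exists>s. winning_strategy (H \<box> F) N s"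
  proof (rule winning_strategy_pairing[OF finite, of mate N resp])
    show "mate x \<in> pverts (H \<box> F) \<and> mate (mate x) = x \<and> mate x \<noteq> x" if "x \<in> pverts (H \<box> F)" for x
      using that bar[of "fst x"] by (cases x) (simp add: mate_def)
    show "resp x r \<in> {1..N}" if "x \<in> pverts (H \<box> F)" "r \<in> {1..N}" for x r
      using resp[OF that] by simp
    fix C assume C: "C \<in> pverts (H \<box> F) \<rightarrow> {1..N}"
      and paired: "\<And>x. x \<in> pverts (H \<box> F) \<Longrightarrow> C (mate x) = resp x (C x) \<or> C x = resp (mate x) (C (mate x))"
    \<comment> \<open>If Gentle colored \<open>(u, f)\<close> in answer to
      \<open>(bar u, f)\<close>, the table yields the reversed pair, which \<open>g_swap\<close>
      turns around. Thus decoding does not depend on who colored which vertex.\<close>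
    have decode: "g (C (u, f)) (C (bar u, f)) = (cf f u, cf f (bar u))" if "u \<in> pverts H" "f \<in> pverts F" for u f
    proof -
      have x: "(u, f) \<in> pverts (H \<box> F)" "(bar u, f) \<in> pverts (H \<box> F)"
        using that bar by auto
      from paired[OF x(1)] show ?thesis
      proof
        assume "C (mate (u, f)) = resp (u, f) (C (u, f))"
        moreover have "C (u, f) \<in> {1..N}"
          using C x(1) by blast
        ultimately show ?thesis
          using resp[OF x(1)] by (simp add: mate_def)
      next
        assume "C (u, f) = resp (mate (u, f)) (C (mate (u, f)))"
        moreover have "C (bar u, f) \<in> {1..N}"
          using C x(2) by blast
        ultimately have "g (C (bar u, f)) (C (u, f)) = (cf f (bar u), cf f u)"
          using resp[OF x(2)] bar[OF that(1)] by (simp add: mate_def)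
        then show ?thesis
          by (subst g_swap) simp
      qed
    qed
    show "distinguishing (H \<box> F) C"
      unfolding distinguishing_def
    proof (intro allI impI)
      fix \<sigma> assume \<sigma>: "graph_automorphism (H \<box> F) \<sigma> \<and> (\<forall>x\<in>pverts (H \<box> F). C (\<sigma> x) = C x)"
      then obtain \<alpha> \<beta> where \<alpha>: "graph_automorphism H \<alpha>" and \<beta>: "graph_automorphism F \<beta>"
        and \<sigma>_eq: "\<And>u f. u \<in> pverts H \<Longrightarrow> f \<in> pverts F \<Longrightarrow> \<sigma> (u, f) = (\<alpha> u, \<beta> f)"
        using cartesian_product_automorphism[OF H assms(2,6,7,8)] by blast
      have \<alpha>_bij: "bij_betw \<alpha> (pverts H) (pverts H)"
        using \<alpha> by (simp add: graph_automorphism_def)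
      have \<beta>_in: "\<beta> f \<in> pverts F" if "f \<in> pverts F" for f
        using \<beta> that by (auto simp: graph_automorphism_def dest: bij_betwE)
      have \<alpha>_in: "\<alpha> u \<in> pverts H" if "u \<in> pverts H" for u
        using \<alpha>_bij that by (auto dest: bij_betwE)
      have C_\<sigma>: "C (\<alpha> u, \<beta> f) = C (u, f)" if "u \<in> pverts H" "f \<in> pverts F" for u f
        using \<sigma> \<sigma>_eq[OF that] that by fastforce
      \<comment> \<open>Since \<open>\<alpha>\<close> commutes with \<open>bar\<close>,
        \<open>\<sigma>\<close> maps game pairs to game pairs with the same colors, and these decode
        to the same values.\<close>
      have cf_inv: "cf (\<beta> f) (\<alpha> u) = cf f u" if "u \<in> pverts H" "f \<in> pverts F" for u f
        using decode[OF that] decode[OF \<alpha>_in[OF that(1)] \<beta>_in[OF that(2)]] C_\<sigma>[OF that]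
          C_\<sigma>[of "bar u" f] bar[OF that(1)] bar_aut[OF \<alpha> that(1)] that(2) by simp
      \<comment> \<open>\<open>\<alpha>\<close> carries the layer coloring over \<open>f\<close> to
        the one over \<open>\<beta> f\<close>, so their profiles agree, and
        \<open>\<chi>_inj\<close> recovers the color.\<close>
      have "cF (\<beta> f) = cF f" if f: "f \<in> pverts F" for f
      proof -
        have up: "unordered_pair bar (cf (\<beta> f)) (\<alpha> u) = unordered_pair bar (cf f) u" if "u \<in> pverts H" for u
          using cf_inv[OF that f] cf_inv[of "bar u" f] bar[OF that] bar_aut[OF \<alpha> that] f
          by (simp add: unordered_pair_def)
        have "card {u \<in> pverts H. unordered_pair bar (cf (\<beta> f)) u = p} =
            card {u \<in> pverts H. unordered_pair bar (cf f) u = p}" for p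
        proof -
          have "{u \<in> pverts H. unordered_pair bar (cf (\<beta> f)) u = p} =
              \<alpha> ` {u \<in> pverts H. unordered_pair bar (cf f) u = p}"
            using up \<alpha>_bij unfolding bij_betw_def by force
          moreover have "inj_on \<alpha> {u \<in> pverts H. unordered_pair bar (cf f) u = p}"
            using \<alpha>_bij unfolding bij_betw_def by (auto intro: inj_on_subset)
          ultimately show ?thesis
            by (simp add: card_image)
        qed
        then show ?thesis
          using inj_onD[OF \<chi>_inj, of "cF (\<beta> f)" "cF f"] cF f \<beta>_in[OF f] unfolding cf_def by blast
      qed
      then have \<beta>_id: "\<beta> f = f" if "f \<in> pverts F" for f
        using dist_cF \<beta> that by (auto simp: distinguishing_def)
      have "c (\<alpha> u) = c u" if "u \<in> pverts H" for u
        using cf_inv[OF that f0] \<beta>_id[OF f0] \<chi>0 by (simp add: cf_def)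
      then have "\<alpha> u = u" if "u \<in> pverts H" for u
        using dist_c \<alpha> that by (auto simp: distinguishing_def)
      then show "\<forall>x\<in>pverts (H \<box> F). \<sigma> x = x"
        using \<sigma>_eq \<beta>_id by auto
    qed
  qed
  \<comment> \<open>The game number admits only positive numbers of colors; \<open>d \<ge> 2\<close>
    gives \<open>N \<ge> 4\<close>.\<close>
  moreover have "N \<ge> 1"
    using mult_mono[OF assms(5) assms(5)] assms(5) by (simp add: N_def power2_eq_square)
  ultimately have "enat N \<in> {enat d | d. d \<ge> 1 \<and> (\<exists>s. winning_strategy (H \<box> F) d s)}"
    by blast
  then show ?thesis
    unfolding rascal_distinguishing_number_def N_def by (rule Inf_lower)
qed

end
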